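(* Let $(\mathbb{X},\mathcal{X},\mathbb{P})$ be a probability space and let $\mathcal{C}\subset\mathcal{X}$ be a countable family of measurable sets which is a VC class of index $d\ge 1$. Then for every $\varepsilon\in(0,1)$ there exist a positive integer $n$ with $$n\le\frac{2576\,d\,(1+\varepsilon)}{\varepsilon^2}$$ and points $x_1,\dots,x_n\in\mathbb{X}$ such that $$D_n^{(\mathcal{C},\mathbb{P})}(x_1,\dots,x_n)\le\varepsilon.$$
   Context: For points $x_1,\dots,x_n\in\mathbb{X}$, the discrepancy is defined by $$D_n^{(\mathcal{C},\mathbb{P})}(x_1,\dots,x_n)=\sup_{C\in\mathcal{C}}\left|\frac1n\sum_{i=1}^n\mathbf{1}_C(x_i)-\mathbb{P}(C)\right|,$$ where $\mathbf{1}_C$ is the indicator function of $C$. A class $\mathcal{C}$ of subsets of $\mathbb{X}$ shatters a finite set $A\subset\mathbb{X}$ if for every subset $B\subset A$ there is $C\in\mathcal{C}$ with $B=A\cap C$. $\mathcal{C}$ is a VC (Vapnik--Chervonenkis) class of index $d$ if $d$ is the largest (finite) number such that $\mathcal{C}$ shatters at least one set of cardinality $d$. *)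

theory Defs
  imports "HOL-Probability.Probability"
begin

text \<open>Only the values \<open>x 1, \<dots>, x n\<close> of the sequence \<open>x\<close> matter. The supremum is taken over the
  reals; for \<open>n > 0\<close> and a probability measure all its members lie in \<open>{0..1}\<close>, so it is the
  genuine least upper bound as soon as \<open>\<C>\<close> is nonempty.\<close>

definition discrepancy ::
  "'a set set \<Rightarrow> 'a measure \<Rightarrow> nat \<Rightarrow> (nat \<Rightarrow> 'a) \<Rightarrow> real" where
  "discrepancy \<C> M n x =
     (SUP C\<in>\<C>. \<bar>1 / real n * (\<Sum>i=1..n. indicator C (x i)) - measure M C\<bar>)"

definition shatters :: "'a set set \<Rightarrow> 'a set \<Rightarrow> bool" where
  "shatters \<C> A \<longleftrightarrow> finite A \<and> (\<forall>B\<subseteq>A. \<exists>C\<in>\<C>. B = A \<inter> C)"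

definition VC_class :: "'a set \<Rightarrow> 'a set set \<Rightarrow> nat \<Rightarrow> bool" where
  "VC_class X \<C> d \<longleftrightarrow>
     (\<exists>A\<subseteq>X. shatters \<C> A \<and> card A = d) \<and>
     (\<forall>A\<subseteq>X. shatters \<C> A \<longrightarrow> card A \<le> d)"

end

theory Submission
  imports Defs
begin

text \<open>
  Draw \<open>x 1, \<dots>, x n\<close> independently from \<open>M\<close>. The expected value of
  \<open>sup C. \<bar>(\<Sum>i=1..n. indicator C (x i)) - n * M C\<bar>\<close> is at most \<open>18 * sqrt (d * n)\<close>, with no
  logarithmic factor; once \<open>n \<ge> 1296 * d / \<epsilon>\<^sup>2\<close> this is at most \<open>n * \<epsilon> / 2\<close>, and by Markov's
  inequality a sample of discrepancy at most \<open>\<epsilon>\<close> occurs with probability at least one half. The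
  constant 2576 therefore leaves room to be generous everywhere below.

  Symmetrization (\<open>symmetrization\<close>) replaces \<open>M C\<close> by the frequency of \<open>C\<close> in an independent
  ghost sample. Exchanging \<open>x i\<close> with its ghost does not change the joint law, so random signs may
  be put in front of the differences. What remains is a purely finite problem: bound the average over
  all sign vectors of \<open>max A\<in>F. \<bar>sum of the signs over A\<bar>\<close>, where \<open>F\<close> is a family of subsets of
  \<open>{1..n}\<close>, the traces of \<open>\<C>\<close> on the sample, and \<open>F\<close> shatters no set of more than \<open>d\<close> indices.

  That problem is solved by chaining (\<open>rademacher_complexity_vc\<close>). A difference of two members of
  \<open>F\<close> which differ in \<open>v\<close> places contributes a sub-Gaussian sum of variance \<open>v\<close>, so a maximum
  over \<open>N\<close> such differences is about \<open>sqrt (2 * v * ln (2 * N))\<close>. Approximating \<open>F\<close> by maximal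
  separated subfamilies at the scales \<open>n / 4 ^ j\<close>, passing from each scale to the next costs
  \<open>sqrt (d * n)\<close> times a quantity of order \<open>j / 2 ^ j\<close>, and these costs are summable. The input is
  that a \<open>\<delta> * n\<close>-separated subfamily has at most about \<open>(4 / \<delta>) ^ (2 * d)\<close> members
  (\<open>separated_family_bound\<close>): few random indices already tell its members apart, and the
  Sauer--Shelah lemma limits the number of traces on these indices. The exponent \<open>2 * d\<close> is not
  optimal (Haussler's theorem gives \<open>d\<close>), but only its logarithm enters.

  Since no compactness is at hand, countable families cannot be reduced to finite ones by choosing
  points for each finite subfamily. What passes to the limit is the probability bound: the sets of
  samples that are bad for the first \<open>k\<close> members increase with \<open>k\<close>, so their union has
  probability at most one half too (\<open>ex_sample_vc_deviation_le\<close>).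
\<close>

section \<open>Shattering and separated families of finite sets\<close>

lemma shattersD: "shatters F S \<Longrightarrow> B \<subseteq> S \<Longrightarrow> \<exists>C\<in>F. B = S \<inter> C"
  by (simp add: shatters_def)

lemma shatters_finite: "shatters F S \<Longrightarrow> finite S"
  by (simp add: shatters_def)

lemma shattersI:
  "finite S \<Longrightarrow> (\<And>B. B \<subseteq> S \<Longrightarrow> \<exists>C\<in>F. B = S \<inter> C) \<Longrightarrow> shatters F S"
  by (simp add: shatters_def)

lemma shatters_subset_ground:
  assumes "F \<subseteq> Pow X" "shatters F S"
  shows "S \<subseteq> X"
proof -
  obtain C where "C \<in> F" "S = S \<inter> C"
    using assms(2) unfolding shatters_def by blast
  with assms(1) show ?thesis by blast
qed

text \<open>Pajor's form of the Sauer--Shelah lemma. Deleting a point \<open>x\<close> splits \<open>F\<close> into the family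
  \<open>F0\<close> of all \<open>A - {x}\<close> and the family \<open>F1\<close> of those sets that arise twice. A set shattered by
  \<open>F0\<close> is shattered by \<open>F\<close>; a set \<open>S\<close> shattered by \<open>F1\<close> makes \<open>F\<close> shatter \<open>insert x S\<close>. The two
  kinds of sets differ in whether they contain \<open>x\<close>, so nothing is counted twice.\<close>
lemma card_le_card_shattered:
  assumes "finite X" "F \<subseteq> Pow X"
  shows "card F \<le> card {S. shatters F S}"
  using assms
proof (induction X arbitrary: F rule: finite_induct)
  case empty
  then consider "F = {}" | "F = {{}}" by (metis Pow_empty subset_singletonD)
  then show ?case
  proof cases
    case 2
    have "{S. shatters F S} = {{}}"
      using shatters_subset_ground[OF empty] by (auto simp: shatters_def 2)
    then show ?thesis using 2 by simp
  qed simp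
next
  case (insert x X)
  define F0 where "F0 = (\<lambda>A. A - {x}) ` F"
  define F1 where "F1 = {A \<in> Pow X. A \<in> F \<and> insert x A \<in> F}"
  have fin: "finite F" "finite F0" "finite F1"
    using insert.hyps(1) insert.prems by (auto simp: F0_def F1_def intro: finite_subset)
  have "card F = card {A\<in>F. x \<notin> A} + card {A\<in>F. x \<in> A}"
    using fin by (subst card_Un_disjoint[symmetric]) (auto intro: arg_cong[where f = card])
  also have "card {A\<in>F. x \<in> A} = card ((\<lambda>A. A - {x}) ` {A\<in>F. x \<in> A})"
    by (intro card_image[symmetric] inj_onI) blast
  also have "card {A\<in>F. x \<notin> A} + \<dots> =
      card ({A\<in>F. x \<notin> A} \<union> (\<lambda>A. A - {x}) ` {A\<in>F. x \<in> A})
      + card ({A\<in>F. x \<notin> A} \<inter> (\<lambda>A. A - {x}) ` {A\<in>F. x \<in> A})"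
    using fin by (intro card_Un_Int) auto
  also have "{A\<in>F. x \<notin> A} \<union> (\<lambda>A. A - {x}) ` {A\<in>F. x \<in> A} = F0"
    unfolding F0_def by (auto simp: image_iff)
  also have "{A\<in>F. x \<notin> A} \<inter> (\<lambda>A. A - {x}) ` {A\<in>F. x \<in> A} = F1"
    unfolding F1_def using insert.prems insert.hyps(2)
    by (auto simp: image_iff insert_absorb)
  finally have card_F: "card F = card F0 + card F1" .
  have ground: "F0 \<subseteq> Pow X" "F1 \<subseteq> Pow X"
    using insert.prems by (auto simp: F0_def F1_def)
  define S0 where "S0 = {S. shatters F0 S}"
  define S1 where "S1 = {S. shatters F1 S}"
  have sub: "S0 \<subseteq> Pow X" "S1 \<subseteq> Pow X"
    using shatters_subset_ground ground by (auto simp: S0_def S1_def)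
  have fin': "finite S0" "finite S1"
    using sub insert.hyps(1) by (auto intro: finite_subset)
  have shattered0: "shatters F S" if "S \<in> S0" for S
  proof -
    have "x \<notin> S" using sub that insert.hyps(2) by blast
    have fin: "finite S" using that by (simp add: S0_def shatters_finite)
    have "\<exists>C\<in>F. B = S \<inter> C" if B: "B \<subseteq> S" for B
    proof -
      have "shatters F0 S" using \<open>S \<in> S0\<close> by (simp add: S0_def)
      from shattersD[OF this B] obtain C where "C \<in> F" "B = S \<inter> (C - {x})"
        unfolding F0_def by blast
      then show ?thesis using \<open>x \<notin> S\<close> by blast
    qed
    with fin show ?thesis by (rule shattersI)
  qed
  have shattered1: "shatters F (insert x S)" if "S \<in> S1" for S
  proof -
    have fin: "finite (insert x S)" using that by (simp add: S1_def shatters_finite)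
    have "\<exists>C\<in>F. B = insert x S \<inter> C" if B: "B \<subseteq> insert x S" for B
    proof -
      have "shatters F1 S" "B - {x} \<subseteq> S" using \<open>S \<in> S1\<close> B by (auto simp: S1_def)
      from shattersD[OF this] obtain C where C: "C \<in> F1" "B - {x} = S \<inter> C" by blast
      then have "x \<notin> C" using insert.hyps(2) by (auto simp: F1_def)
      show ?thesis
      proof (cases "x \<in> B")
        case True
        then have "B = insert x S \<inter> insert x C" using C(2) by blast
        then show ?thesis using C(1) by (auto simp: F1_def)
      next
        case False
        then have "B = insert x S \<inter> C" using C(2) \<open>x \<notin> C\<close> by blast
        then show ?thesis using C(1) by (auto simp: F1_def)
      qed
    qed
    with fin show ?thesis by (rule shattersI)
  qed
  have inj: "inj_on (insert x) S1"
  proof (rule inj_onI)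
    fix A B assume "A \<in> S1" "B \<in> S1" "insert x A = insert x B"
    moreover have "x \<notin> A" "x \<notin> B" using sub calculation(1,2) insert.hyps(2) by blast+
    ultimately show "A = B" by (metis insert_ident)
  qed
  have "card S0 + card S1 = card S0 + card (insert x ` S1)"
    using inj by (simp add: card_image)
  also have "\<dots> = card (S0 \<union> insert x ` S1)"
    using sub insert.hyps(2) fin' by (intro card_Un_disjoint[symmetric]) auto
  also have "\<dots> \<le> card {S. shatters F S}"
  proof (rule card_mono)
    have "{S. shatters F S} \<subseteq> Pow (insert x X)"
    proof
      fix S assume "S \<in> {S. shatters F S}"
      then have "shatters F S" by (rule CollectD)
      from shatters_subset_ground[OF insert.prems this] show "S \<in> Pow (insert x X)" by (rule PowI)
    qed
    then show "finite {S. shatters F S}"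
      by (rule finite_subset) (simp add: insert.hyps(1))
    show "S0 \<union> insert x ` S1 \<subseteq> {S. shatters F S}"
      using shattered0 shattered1 by (intro Un_least subsetI) (simp_all only: mem_Collect_eq image_iff, blast)
  qed
  finally show ?case
    using card_F insert.IH[OF ground(1)] insert.IH[OF ground(2)] by (simp add: S0_def S1_def)
qed

lemma sum_power_card_Pow:
  fixes x :: real
  assumes "finite T"
  shows "(\<Sum>S\<in>Pow T. x ^ card S) = (1 + x) ^ card T"
  using prod_add[OF assms, of "\<lambda>_. x" "\<lambda>_. 1"] by (simp add: add.commute)

text \<open>The number of subsets of size at most \<open>d\<close> is bounded by giving each subset \<open>S\<close> the weight
  \<open>x ^ card S / x ^ d\<close>. Leaving \<open>x\<close> free avoids the side condition \<open>d \<le> card T\<close> of the usual bound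
  \<open>(e * card T / d) ^ d\<close>, and \<open>x\<close> can be tuned to the application.\<close>
lemma sauer_shelah_exp:
  fixes x :: real
  assumes "finite T" "F \<subseteq> Pow T" "\<And>S. shatters F S \<Longrightarrow> card S \<le> d" "0 < x" "x \<le> 1"
  shows "real (card F) * x ^ d \<le> exp (x * real (card T))"
proof -
  have sub: "{S. shatters F S} \<subseteq> Pow T"
    using shatters_subset_ground[OF assms(2)] by blast
  have "real (card F) * x ^ d \<le> real (card {S. shatters F S}) * x ^ d"
    using card_le_card_shattered[OF assms(1,2)] assms(4) by (intro mult_right_mono) auto
  also have "\<dots> = (\<Sum>S | shatters F S. x ^ d)" by simp
  also have "\<dots> \<le> (\<Sum>S | shatters F S. x ^ card S)"
    using assms(3-5) by (intro sum_mono power_decreasing) auto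
  also have "\<dots> \<le> (\<Sum>S\<in>Pow T. x ^ card S)"
    using sub assms(1,4) by (intro sum_mono2) auto
  also have "\<dots> = (1 + x) ^ card T"
    by (rule sum_power_card_Pow[OF assms(1)])
  also have "\<dots> \<le> exp x ^ card T"
    using assms(4) by (intro power_mono exp_ge_add_one_self) auto
  also have "\<dots> = exp (x * real (card T))"
    by (simp add: exp_of_nat_mult[symmetric] mult.commute)
  finally show ?thesis .
qed

text \<open>Random sampling, done by counting. A uniformly random \<open>m\<close>-tuple of indices misses the
  symmetric difference of a given pair with probability at most
  \<open>(1 - \<delta>) ^ m \<le> exp (- \<delta> * m) \<le> 1 / N\<^sup>2\<close>, where \<open>N = card G\<close>. There are \<open>N\<^sup>2 - N\<close> ordered pairs
  of distinct members, so some tuple misses none of these symmetric differences.\<close>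
lemma ex_separating_sample:
  fixes \<delta> :: real
  assumes "finite I" "G \<subseteq> Pow I" "G \<noteq> {}" "0 < \<delta>" "\<delta> \<le> 1"
    and sep: "\<And>A B. A \<in> G \<Longrightarrow> B \<in> G \<Longrightarrow> A \<noteq> B \<Longrightarrow> \<delta> * real (card I) \<le> real (card (sym_diff A B))"
    and m: "2 * ln (real (card G)) \<le> \<delta> * real m"
  shows "\<exists>T\<subseteq>I. card T \<le> m \<and> inj_on (\<lambda>A. A \<inter> T) G"
proof (cases "I = {}")
  case True
  then show ?thesis using assms(2) by (intro exI[of _ "{}"]) (auto simp: inj_on_def)
next
  case False
  define n where "n = card I"
  have n: "n > 0" using False assms(1) by (simp add: n_def card_gt_0_iff)
  define N where "N = card G"
  have fin: "finite G" using assms(1,2) by (auto intro: finite_subset)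
  have N: "N \<ge> 1" using fin assms(3) by (simp add: N_def Suc_le_eq card_gt_0_iff)
  define \<Omega> where "\<Omega> = PiE {..<m} (\<lambda>_. I)"
  define bad where "bad = (\<lambda>(A,B). PiE {..<m} (\<lambda>_. I - sym_diff A B))"
  define P where "P = G \<times> G - (\<lambda>A. (A, A)) ` G"
  have finP: "finite P" using fin by (simp add: P_def)
  have "card P = N * N - N"
    unfolding P_def N_def using fin
    by (subst card_Diff_subset) (auto simp: card_image inj_on_def)
  then have card_P: "real (card P) = real N * real N - real N"
    using N by (simp add: of_nat_diff)
  have card_bad: "real (card (bad p)) \<le> real n ^ m / real N ^ 2" if "p \<in> P" for p
  proof -
    obtain A B where p: "p = (A, B)" "A \<in> G" "B \<in> G" "A \<noteq> B" using \<open>p \<in> P\<close> by (auto simp: P_def)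
    have "sym_diff A B \<subseteq> I" using p assms(2) by blast
    then have "real (card (I - sym_diff A B)) = real n - real (card (sym_diff A B))"
      using assms(1) by (subst card_Diff_subset)
        (auto simp: n_def intro: finite_subset card_mono of_nat_diff)
    also have "\<dots> \<le> (1 - \<delta>) * real n" using sep[OF p(2-4)] by (simp add: n_def algebra_simps)
    also have "\<dots> \<le> exp (- \<delta>) * real n"
      using exp_ge_add_one_self[of "- \<delta>"] by (intro mult_right_mono) auto
    finally have "real (card (I - sym_diff A B)) ^ m \<le> (exp (- \<delta>) * real n) ^ m"
      by (intro power_mono) auto
    also have "\<dots> = real n ^ m * exp (- (\<delta> * real m))"
      by (simp add: power_mult_distrib exp_of_nat_mult[symmetric] mult.commute)
    also have "\<dots> \<le> real n ^ m * exp (- (2 * ln (real N)))"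
      using m by (intro mult_left_mono) (auto simp: N_def)
    also have "exp (- (2 * ln (real N))) = 1 / real N ^ 2"
      using N by (simp add: exp_minus exp_double power2_eq_square field_simps)
    finally show ?thesis by (simp add: p bad_def card_PiE)
  qed
  have "real (card (\<Union> (bad ` P))) \<le> (\<Sum>p\<in>P. real (card (bad p)))"
    unfolding of_nat_sum[symmetric] of_nat_le_iff by (rule card_UN_le[OF finP])
  also have "\<dots> \<le> (real N * real N - real N) * (real n ^ m / real N ^ 2)"
    using sum_bounded_above[of P, OF card_bad] by (simp add: card_P)
  also have "\<dots> = real n ^ m - real n ^ m / real N"
    using N by (simp add: field_simps power2_eq_square)
  finally have le: "real (card (\<Union> (bad ` P))) \<le> real n ^ m - real n ^ m / real N" .
  have "\<not> \<Omega> \<subseteq> \<Union> (bad ` P)"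
  proof
    assume sub: "\<Omega> \<subseteq> \<Union> (bad ` P)"
    have bad_sub: "bad p \<subseteq> \<Omega>" for p
      by (auto simp: bad_def \<Omega>_def PiE_def split: prod.split) 
    have fin\<Omega>: "finite \<Omega>" unfolding \<Omega>_def using assms(1) by (intro finite_PiE) auto
    have "real n ^ m = real (card \<Omega>)" by (simp add: \<Omega>_def card_PiE n_def)
    also have "\<dots> \<le> real (card (\<Union> (bad ` P)))"
      using sub bad_sub fin\<Omega> by (intro of_nat_mono card_mono finite_subset[OF UN_least]) auto
    also note le
    finally have "real n ^ m / real N \<le> 0" by simp
    moreover have "0 < real n ^ m / real N" using N n by simp
    ultimately show False by simp
  qed
  then obtain f where f: "f \<in> \<Omega>" "\<And>p. p \<in> P \<Longrightarrow> f \<notin> bad p" by blast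
  have "inj_on (\<lambda>A. A \<inter> f ` {..<m}) G"
  proof (rule inj_onI, rule ccontr)
    fix A B assume AB: "A \<in> G" "B \<in> G" "A \<inter> f ` {..<m} = B \<inter> f ` {..<m}" "A \<noteq> B"
    then have "(A, B) \<in> P" by (auto simp: P_def)
    moreover have "f \<in> bad (A, B)"
      using AB(3) f(1) by (auto simp: bad_def \<Omega>_def PiE_iff)
    ultimately show False using f(2) by blast
  qed
  moreover have "f ` {..<m} \<subseteq> I" using f(1) by (auto simp: \<Omega>_def)
  moreover have "card (f ` {..<m}) \<le> m" using card_image_le[of "{..<m}" f] by simp
  ultimately show ?thesis by blast
qed

text \<open>Write \<open>L = ln (card G)\<close>. About \<open>2 * L / \<delta>\<close> indices separate the members of \<open>G\<close>, and the
  Sauer--Shelah bound for their traces reads \<open>L \<le> d * ln (1 / x) + x * (2 * L / \<delta> + 1)\<close>. The choice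
  \<open>x = \<delta> / 4\<close> turns the last term into \<open>L / 2\<close> plus a small constant, which is absorbed on the
  left.\<close>
lemma separated_family_bound:
  fixes \<delta> :: real
  assumes "finite I" "G \<subseteq> Pow I" "G \<noteq> {}" "0 < \<delta>" "\<delta> \<le> 1"
    and sep: "\<And>A B. A \<in> G \<Longrightarrow> B \<in> G \<Longrightarrow> A \<noteq> B \<Longrightarrow> \<delta> * real (card I) \<le> real (card (sym_diff A B))"
    and vc: "\<And>S. shatters G S \<Longrightarrow> card S \<le> d"
  shows "ln (real (card G)) \<le> 2 * real d * ln (4 / \<delta>) + 1 / 2"
proof -
  define L where "L = ln (real (card G))"
  define m where "m = nat \<lceil>2 * L / \<delta>\<rceil>"
  have fin: "finite G" using assms(1,2) by (auto intro: finite_subset)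
  have N: "card G \<ge> 1" using fin assms(3) by (simp add: Suc_le_eq card_gt_0_iff)
  then have L: "L \<ge> 0" by (simp add: L_def)
  have "2 * L / \<delta> \<le> real m" "real m \<le> 2 * L / \<delta> + 1"
    using L assms(4) by (simp_all add: m_def real_nat_ceiling_ge)
  then have m: "2 * L \<le> \<delta> * real m" "\<delta> * real m \<le> 2 * L + \<delta>"
    using assms(4) by (simp_all add: field_simps)
  obtain T where T: "T \<subseteq> I" "card T \<le> m" "inj_on (\<lambda>A. A \<inter> T) G"
    using ex_separating_sample[OF assms(1-5) sep m(1)[unfolded L_def]] by blast
  have finT: "finite T" using T(1) assms(1) finite_subset by blast
  define H where "H = (\<lambda>A. A \<inter> T) ` G"
  have H: "H \<subseteq> Pow T" by (auto simp: H_def)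
  have vcH: "card S \<le> d" if "shatters H S" for S
  proof (rule vc)
    have "S \<subseteq> T" using shatters_subset_ground[OF H that] .
    have "\<exists>C\<in>G. B = S \<inter> C" if B: "B \<subseteq> S" for B
    proof -
      obtain C' where "C' \<in> H" "B = S \<inter> C'"
        using shattersD[OF \<open>shatters H S\<close> B] by (elim bexE)
      then obtain C where "C \<in> G" "B = S \<inter> (C \<inter> T)"
        unfolding H_def by blast
      then show ?thesis using \<open>S \<subseteq> T\<close> by blast
    qed
    with shatters_finite[OF that] show "shatters G S" by (rule shattersI)
  qed
  have "real (card G) * (\<delta> / 4) ^ d \<le> exp (\<delta> / 4 * real (card T))"
    using sauer_shelah_exp[OF finT H vcH, of "\<delta> / 4"] assms(4,5) T(3)
    by (simp add: H_def card_image)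
  also have "\<dots> \<le> exp (\<delta> / 4 * real m)" using T(2) assms(4) by simp
  finally have "ln (real (card G) * (\<delta> / 4) ^ d) \<le> ln (exp (\<delta> / 4 * real m))"
    using N assms(4) by (subst ln_le_cancel_iff) auto
  then have "L + real d * ln (\<delta> / 4) \<le> \<delta> / 4 * real m"
    using N assms(4) by (simp add: L_def ln_mult ln_realpow)
  moreover have "ln (\<delta> / 4) = - ln (4 / \<delta>)" using assms(4) by (simp add: ln_div)
  ultimately have "L - real d * ln (4 / \<delta>) \<le> (2 * L + \<delta>) / 4" using m(2) by simp
  then show ?thesis using assms(5) by (simp add: L_def field_simps)
qed

section \<open>Sums with random signs\<close>

text \<open>A vector of signs indexed by \<open>I\<close> is encoded by the set \<open>S \<subseteq> I\<close> of its positive entries, so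
  that averaging over independent fair signs is a finite sum over \<open>Pow I\<close>.\<close>
definition rademacher_sum :: "'i set \<Rightarrow> ('i \<Rightarrow> real) \<Rightarrow> 'i set \<Rightarrow> real" where
  "rademacher_sum I a S = (\<Sum>i\<in>I. (if i \<in> S then 1 else - 1) * a i)"

definition sign_mean :: "'i set \<Rightarrow> ('i set \<Rightarrow> real) \<Rightarrow> real" where
  "sign_mean I g = (\<Sum>S\<in>Pow I. g S) / 2 ^ card I"

lemma sign_mean_mono: "(\<And>S. S \<subseteq> I \<Longrightarrow> f S \<le> g S) \<Longrightarrow> sign_mean I f \<le> sign_mean I g"
  unfolding sign_mean_def by (intro divide_right_mono sum_mono) auto

lemma sign_mean_add: "sign_mean I (\<lambda>S. f S + g S) = sign_mean I f + sign_mean I g"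
  by (simp add: sign_mean_def sum.distrib add_divide_distrib)

lemma sign_mean_cmult: "sign_mean I (\<lambda>S. c * f S) = c * sign_mean I f"
  by (simp add: sign_mean_def sum_distrib_left)

lemma sign_mean_sum: "sign_mean I (\<lambda>S. \<Sum>k\<in>K. f k S) = (\<Sum>k\<in>K. sign_mean I (f k))"
  unfolding sign_mean_def by (subst sum.swap) (simp add: sum_divide_distrib)

lemma sign_mean_const: "finite I \<Longrightarrow> sign_mean I (\<lambda>S. c) = c"
  by (simp add: sign_mean_def card_Pow)

lemma rademacher_sum_diff:
  "rademacher_sum I (\<lambda>i. a i - b i) S = rademacher_sum I a S - rademacher_sum I b S"
  by (simp add: rademacher_sum_def right_diff_distrib sum_subtractf)

lemma rademacher_sum_cmult:
  "rademacher_sum I (\<lambda>i. c * a i) S = c * rademacher_sum I a S"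
  by (simp add: rademacher_sum_def sum_distrib_left mult.left_commute)

text \<open>This is \<open>cosh x \<le> exp (x\<^sup>2 / 2)\<close>, obtained from Hoeffding's lemma for a fair sign.\<close>
lemma exp_add_exp_minus_le: "exp x + exp (- x) \<le> 2 * exp (x\<^sup>2 / 2)" for x :: real
proof -
  have *: "exp x + exp (- x) \<le> 2 * exp (x\<^sup>2 / 2)" if "x \<ge> 0" for x :: real
  proof -
    have "- (2 * x) * (1 / 2) + ln (1 + 1 / 2 * (exp (2 * x) - 1)) \<le> (2 * x)\<^sup>2 / 8"
      using that by (intro Hoeffdings_lemma_aux) auto
    then have "ln ((1 + exp (2 * x)) / 2) \<le> x + x\<^sup>2 / 2"
      by (simp add: field_simps power2_eq_square)
    then have "exp (ln ((1 + exp (2 * x)) / 2)) \<le> exp (x + x\<^sup>2 / 2)"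
      by (simp only: exp_le_cancel_iff)
    then have "(1 + exp (2 * x)) / 2 \<le> exp x * exp (x\<^sup>2 / 2)"
      by (subst (asm) exp_ln) (auto simp: exp_add add_pos_pos)
    then have "exp (- x) * (1 + exp (2 * x)) \<le> exp (- x) * (2 * (exp x * exp (x\<^sup>2 / 2)))"
      by (intro mult_left_mono) auto
    also have "\<dots> = 2 * exp (x\<^sup>2 / 2)" by (simp add: exp_minus)
    also have "exp (- x) * (1 + exp (2 * x)) = exp x + exp (- x)"
      by (simp add: distrib_left exp_add[symmetric])
    finally show ?thesis .
  qed
  show ?thesis
    using *[of x] *[of "- x"] by (cases "x \<ge> 0") (auto simp: add.commute)
qed

text \<open>Signed sums are sub-Gaussian: by independence the exponential moment is the product of the
  factors \<open>cosh (a i)\<close>. Here independence is the expansion of a product of binomials.\<close>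
lemma sign_mean_exp_le:
  assumes "finite I"
  shows "sign_mean I (\<lambda>S. exp (rademacher_sum I a S)) \<le> exp ((\<Sum>i\<in>I. (a i)\<^sup>2) / 2)"
proof -
  have "(\<Sum>S\<in>Pow I. exp (rademacher_sum I a S)) =
      (\<Sum>S\<in>Pow I. (\<Prod>i\<in>S. exp (a i)) * (\<Prod>i\<in>I - S. exp (- a i)))"
  proof (intro sum.cong refl)
    fix S assume "S \<in> Pow I"
    then have fin: "finite S" using assms finite_subset by blast
    have "rademacher_sum I a S = (\<Sum>i\<in>S. a i) + (\<Sum>i\<in>I - S. - a i)"
      unfolding rademacher_sum_def
      using \<open>S \<in> Pow I\<close>
      by (subst sum.subset_diff[of S]) (auto simp: assms add.commute intro!: arg_cong2[where f = "(+)"] sum.cong)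
    then show "exp (rademacher_sum I a S) = (\<Prod>i\<in>S. exp (a i)) * (\<Prod>i\<in>I - S. exp (- a i))"
      using assms fin by (simp only: exp_add exp_sum finite_Diff)
  qed
  also have "\<dots> = (\<Prod>i\<in>I. exp (a i) + exp (- a i))"
    by (rule prod_add[OF assms, symmetric])
  also have "\<dots> \<le> (\<Prod>i\<in>I. 2 * exp ((a i)\<^sup>2 / 2))"
    by (intro prod_mono) (auto simp: exp_add_exp_minus_le add_nonneg_nonneg)
  also have "\<dots> = 2 ^ card I * exp ((\<Sum>i\<in>I. (a i)\<^sup>2) / 2)"
    using assms by (simp add: prod.distrib exp_sum sum_divide_distrib)
  finally show ?thesis by (simp add: sign_mean_def field_simps)
qed

text \<open>The maximal inequality for sub-Gaussian sums. Instead of Jensen's inequality for \<open>exp\<close>, the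
  tangent \<open>1 + t \<le> exp t\<close> is used at \<open>t = l * m - c\<close>, where \<open>m\<close> is the maximum and \<open>c\<close> is
  chosen to make the bound for the mean of \<open>exp t\<close> equal to 1. The optimal \<open>l\<close> would give
  \<open>sqrt (2 * v * ln (2 * card K))\<close>; keeping \<open>l\<close> free lets the caller avoid the square root.\<close>
lemma sign_mean_Max_le:
  fixes a :: "'k \<Rightarrow> 'i \<Rightarrow> real"
  assumes "finite I" "finite K" "K \<noteq> {}" "0 < l"
    and v: "\<And>k. k \<in> K \<Longrightarrow> (\<Sum>i\<in>I. (a k i)\<^sup>2) \<le> v"
  shows "sign_mean I (\<lambda>S. MAX k\<in>K. \<bar>rademacher_sum I (a k) S\<bar>)
    \<le> (ln (2 * real (card K)) + l\<^sup>2 * v / 2) / l"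
proof -
  define c where "c = ln (2 * real (card K)) + l\<^sup>2 * v / 2"
  define m where "m = (\<lambda>S. MAX k\<in>K. \<bar>rademacher_sum I (a k) S\<bar>)"
  define p where "p = (\<lambda>k S. exp (rademacher_sum I (\<lambda>i. l * a k i) S))"
  define q where "q = (\<lambda>k S. exp (rademacher_sum I (\<lambda>i. - l * a k i) S))"
  have card: "real (card K) > 0" using assms(2,3) by (simp add: card_gt_0_iff)
  have "sign_mean I (\<lambda>S. l * m S + (1 - c)) \<le> sign_mean I (\<lambda>S. exp (- c) * (\<Sum>k\<in>K. p k S + q k S))"
  proof (rule sign_mean_mono)
    fix S
    have "m S \<in> (\<lambda>k. \<bar>rademacher_sum I (a k) S\<bar>) ` K"
      unfolding m_def using assms(2,3) by (intro Max_in) auto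
    then obtain k where k: "k \<in> K" "m S = \<bar>rademacher_sum I (a k) S\<bar>" by auto
    have "l * m S + (1 - c) \<le> exp (- c + l * m S)"
      using exp_ge_add_one_self[of "- c + l * m S"] by (simp only: algebra_simps)
    also have "\<dots> = exp (- c) * exp (l * m S)" by (rule exp_add)
    also have "exp (l * m S) \<le> p k S + q k S"
      unfolding k(2) p_def q_def rademacher_sum_cmult by (simp add: abs_if add_increasing add_increasing2)
    also have "p k S + q k S \<le> (\<Sum>k\<in>K. p k S + q k S)"
      using k(1) assms(2) by (intro member_le_sum) (auto simp: p_def q_def add_nonneg_nonneg)
    finally show "l * m S + (1 - c) \<le> exp (- c) * (\<Sum>k\<in>K. p k S + q k S)" by simp
  qed
  also have "sign_mean I (\<lambda>S. l * m S + (1 - c)) = l * sign_mean I m + (1 - c)"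
    using assms(1) by (simp add: sign_mean_add sign_mean_cmult sign_mean_const)
  also have "sign_mean I (\<lambda>S. exp (- c) * (\<Sum>k\<in>K. p k S + q k S)) =
      exp (- c) * (\<Sum>k\<in>K. sign_mean I (p k) + sign_mean I (q k))"
    by (simp add: sign_mean_cmult sign_mean_sum sign_mean_add)
  also have "\<dots> \<le> exp (- c) * (\<Sum>k\<in>K. 2 * exp (l\<^sup>2 * v / 2))"
  proof (intro mult_left_mono sum_mono)
    fix k assume "k \<in> K"
    have *: "sign_mean I (\<lambda>S. exp (rademacher_sum I (\<lambda>i. t * a k i) S)) \<le> exp (l\<^sup>2 * v / 2)"
      if "t\<^sup>2 = l\<^sup>2" for t
    proof -
      have "sign_mean I (\<lambda>S. exp (rademacher_sum I (\<lambda>i. t * a k i) S))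
          \<le> exp ((\<Sum>i\<in>I. (t * a k i)\<^sup>2) / 2)"
        by (rule sign_mean_exp_le[OF assms(1)])
      also have "(\<Sum>i\<in>I. (t * a k i)\<^sup>2) = l\<^sup>2 * (\<Sum>i\<in>I. (a k i)\<^sup>2)"
        by (simp add: power_mult_distrib that sum_distrib_left)
      also have "\<dots> \<le> l\<^sup>2 * v" using v[OF \<open>k \<in> K\<close>] by (intro mult_left_mono) auto
      finally show ?thesis by simp
    qed
    show "sign_mean I (p k) + sign_mean I (q k) \<le> 2 * exp (l\<^sup>2 * v / 2)"
      using *[of l] *[of "- l"] by (simp add: p_def q_def)
  qed auto
  also have "\<dots> = 1"
  proof -
    have "exp c = 2 * real (card K) * exp (l\<^sup>2 * v / 2)" using card by (simp add: c_def exp_add)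
    then show ?thesis using card by (simp add: exp_minus field_simps)
  qed
  finally have "l * sign_mean I m \<le> c" by simp
  then show ?thesis using assms(4) by (simp add: m_def c_def field_simps)
qed

section \<open>Chaining\<close>

text \<open>A maximal \<open>r\<close>-separated subset is a net at scale \<open>r\<close>: a point far from all its members could
  be added to it.\<close>
lemma ex_separated_net:
  fixes D :: "'b \<Rightarrow> 'b \<Rightarrow> real"
  assumes "finite F" "\<And>A B. D A B = D B A"
  obtains G where "G \<subseteq> F" "\<And>A B. A \<in> G \<Longrightarrow> B \<in> G \<Longrightarrow> A \<noteq> B \<Longrightarrow> r < D A B"
    "\<And>A. A \<in> F \<Longrightarrow> A \<in> G \<or> (\<exists>B\<in>G. D A B \<le> r)"
proof -
  define \<S> where "\<S> = {G. G \<subseteq> F \<and> (\<forall>A\<in>G. \<forall>B\<in>G. A \<noteq> B \<longrightarrow> r < D A B)}"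
  have "finite \<S>" using assms(1) by (intro finite_subset[of \<S> "Pow F"]) (auto simp: \<S>_def)
  moreover have "{} \<in> \<S>" by (simp add: \<S>_def)
  ultimately obtain G where G: "G \<in> \<S>" "\<And>H. H \<in> \<S> \<Longrightarrow> G \<subseteq> H \<Longrightarrow> G = H"
    using finite_has_maximal[of \<S>] by blast
  show thesis
  proof
    fix A assume A: "A \<in> F"
    show "A \<in> G \<or> (\<exists>B\<in>G. D A B \<le> r)"
    proof (rule ccontr)
      assume contr: "\<not> ?thesis"
      then have "insert A G \<in> \<S>"
        using G(1) A assms(2) by (auto simp: \<S>_def not_le)
      then show False using G(2)[of "insert A G"] contr by blast
    qed
  qed (use G(1) in \<open>auto simp: \<S>_def\<close>)
qed

text \<open>The scaling is by sums, not means: dividing by \<open>card I\<close> gives the usual Rademacher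
  complexity of the indicators of \<open>F\<close>.\<close>
definition rademacher_complexity :: "'i set \<Rightarrow> 'i set set \<Rightarrow> real" where
  "rademacher_complexity I F =
     sign_mean I (\<lambda>S. MAX A\<in>F. \<bar>rademacher_sum I (indicator A) S\<bar>)"

text \<open>One link of the chain. Each member of \<open>G\<close> is moved to a near member of \<open>H\<close>. The signed sum over
  the difference has variance at most \<open>v\<close>, and there are only \<open>card G\<close> differences to control.\<close>
lemma rademacher_complexity_refine:
  fixes l v :: real
  assumes "finite I" "finite G" "G \<noteq> {}" "finite H" "G \<subseteq> Pow I" "H \<subseteq> Pow I" "0 < l"
    and near: "\<And>A. A \<in> G \<Longrightarrow> \<exists>B\<in>H. real (card (sym_diff A B)) \<le> v"
  shows "rademacher_complexity I G
    \<le> rademacher_complexity I H + (ln (2 * real (card G)) + l\<^sup>2 * v / 2) / l"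
proof -
  obtain \<pi> where \<pi>: "\<And>A. A \<in> G \<Longrightarrow> \<pi> A \<in> H" "\<And>A. A \<in> G \<Longrightarrow> real (card (sym_diff A (\<pi> A))) \<le> v"
    using near by metis
  define link where "link = (\<lambda>A i. indicator A i - indicator (\<pi> A) i :: real)"
  have "rademacher_complexity I G \<le> sign_mean I (\<lambda>S.
      (MAX A\<in>H. \<bar>rademacher_sum I (indicator A) S\<bar>) + (MAX A\<in>G. \<bar>rademacher_sum I (link A) S\<bar>))"
    unfolding rademacher_complexity_def
  proof (intro sign_mean_mono Max.boundedI)
    fix S r assume "r \<in> (\<lambda>A. \<bar>rademacher_sum I (indicator A) S\<bar>) ` G"
    then obtain A where A: "A \<in> G" "r = \<bar>rademacher_sum I (indicator A) S\<bar>" by blast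
    have "r \<le> \<bar>rademacher_sum I (indicator (\<pi> A)) S\<bar> + \<bar>rademacher_sum I (link A) S\<bar>"
      unfolding A(2) link_def rademacher_sum_diff by linarith
    also have "\<dots> \<le> (MAX A\<in>H. \<bar>rademacher_sum I (indicator A) S\<bar>)
        + (MAX A\<in>G. \<bar>rademacher_sum I (link A) S\<bar>)"
      using A(1) \<pi>(1) assms(2,4) by (intro add_mono Max_ge) auto
    finally show "r \<le> (MAX A\<in>H. \<bar>rademacher_sum I (indicator A) S\<bar>)
        + (MAX A\<in>G. \<bar>rademacher_sum I (link A) S\<bar>)" .
  qed (use assms(2,3) in auto)
  also have "\<dots> = rademacher_complexity I H
      + sign_mean I (\<lambda>S. MAX A\<in>G. \<bar>rademacher_sum I (link A) S\<bar>)"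
    by (simp add: sign_mean_add rademacher_complexity_def)
  also have "sign_mean I (\<lambda>S. MAX A\<in>G. \<bar>rademacher_sum I (link A) S\<bar>)
      \<le> (ln (2 * real (card G)) + l\<^sup>2 * v / 2) / l"
  proof (rule sign_mean_Max_le[OF assms(1-3,7)])
    fix A assume "A \<in> G"
    then have sub: "sym_diff A (\<pi> A) \<subseteq> I" using \<pi>(1) assms(5,6) by blast
    have "(\<Sum>i\<in>I. (link A i)\<^sup>2) = (\<Sum>i\<in>I. indicator (sym_diff A (\<pi> A)) i)"
      by (intro sum.cong) (auto simp: link_def indicator_def)
    also have "\<dots> = real (card (sym_diff A (\<pi> A)))"
      using sum.inter_restrict[OF assms(1), of "\<lambda>_. 1 :: real" "sym_diff A (\<pi> A)"] Int_absorb1[OF sub]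
      by (simp add: indicator_def of_bool_def)
    finally show "(\<Sum>i\<in>I. (link A i)\<^sup>2) \<le> v" using \<pi>(2)[OF \<open>A \<in> G\<close>] by simp
  qed
  finally show ?thesis by simp
qed

text \<open>The chain starts at \<open>{{}}\<close>, within distance \<open>n\<close> of everything, and runs through maximal
  \<open>n / 4 ^ j\<close>-separated subfamilies; for \<open>n < 4 ^ j\<close> this is all of \<open>F\<close>, because distances are
  integers. With \<open>s = sqrt (d * n)\<close>, the step from level \<open>j\<close> to level \<open>j + 1\<close> costs at most
  \<open>s * (15 / 4 + 3 / 4 * j) / 2 ^ j\<close>, and these costs sum to \<open>9 * s\<close>.\<close>
lemma rademacher_complexity_vc:
  assumes "finite I" "I \<noteq> {}" "F \<subseteq> Pow I" "F \<noteq> {}" "d \<ge> 1"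
    and vc: "\<And>S. shatters F S \<Longrightarrow> card S \<le> d"
  shows "rademacher_complexity I F \<le> 9 * sqrt (real d * real (card I))"
proof -
  define n where "n = card I"
  have n: "n \<ge> 1" using assms(1,2) by (simp add: n_def Suc_le_eq card_gt_0_iff)
  define s where "s = sqrt (real d * real n)"
  have s: "s > 0" "s * s = real d * real n" using n assms(5) by (auto simp: s_def)
  have finF: "finite F" using assms(1,3) by (auto intro: finite_subset)
  define D where "D = (\<lambda>A B :: 'a set. real (card (sym_diff A B)))"
  have D: "D A B = D B A" "D A A = 0" for A B by (simp_all add: D_def Un_commute)
  have "\<exists>G. G \<subseteq> F \<and> (\<forall>A\<in>G. \<forall>B\<in>G. A \<noteq> B \<longrightarrow> n / 4 ^ j < D A B) \<and> (\<forall>A\<in>F. \<exists>B\<in>G. D A B \<le> n / 4 ^ j)"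
    for j :: nat
  proof (rule ex_separated_net[OF finF D(1)])
    fix G assume G: "G \<subseteq> F" "\<And>A B. A \<in> G \<Longrightarrow> B \<in> G \<Longrightarrow> A \<noteq> B \<Longrightarrow> n / 4 ^ j < D A B"
      "\<And>A. A \<in> F \<Longrightarrow> A \<in> G \<or> (\<exists>B\<in>G. D A B \<le> n / 4 ^ j)"
    have "\<exists>B\<in>G. D A B \<le> n / 4 ^ j" if "A \<in> F" for A
      using G(3)[OF that] D(2)[of A] by (metis divide_nonneg_nonneg of_nat_0_le_iff zero_le_numeral zero_le_power)
    then show ?thesis using G(1,2) by blast
  qed
  then obtain G where G: "\<And>j. G j \<subseteq> F"
    "\<And>j A B. A \<in> G j \<Longrightarrow> B \<in> G j \<Longrightarrow> A \<noteq> B \<Longrightarrow> n / 4 ^ j < D A B"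
    "\<And>j A. A \<in> F \<Longrightarrow> \<exists>B\<in>G j. D A B \<le> n / 4 ^ j"
    by metis
  define H where "H = (\<lambda>j. if j = 0 then {{}} else G j)"
  have G_ne: "G j \<noteq> {}" for j using G(3) assms(4) by blast
  have G_sub: "G j \<subseteq> Pow I" for j using G(1) assms(3) by blast
  have H: "H j \<subseteq> Pow I" "finite (H j)" for j
    using G_sub assms(1) finite_subset[OF G_sub] by (auto simp: H_def)
  have ln_card: "ln (2 * real (card (G (Suc j)))) \<le> real d * (7 + 3 * real j)" for j
  proof -
    have pos: "card (G (Suc j)) > 0" using G_ne H(2)[of "Suc j"] by (simp add: H_def card_gt_0_iff)
    have "ln (real (card (G (Suc j)))) \<le> 2 * real d * ln (4 / (1 / 4 ^ Suc j)) + 1 / 2"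
    proof (rule separated_family_bound[OF assms(1) G_sub G_ne])
      show "card S \<le> d" if "shatters (G (Suc j)) S" for S
        using G(1)[of "Suc j"] shattersD[OF that] shatters_finite[OF that]
        by (intro vc shattersI) blast+
      show "1 / 4 ^ Suc j * real (card I) \<le> real (card (sym_diff A B))"
        if "A \<in> G (Suc j)" "B \<in> G (Suc j)" "A \<noteq> B" for A B
        using G(2)[OF that] by (simp add: D_def n_def)
    qed (use one_le_power[of "4 :: real" "Suc j"] in \<open>simp_all add: field_simps\<close>)
    also have "4 / (1 / 4 ^ Suc j) = (2::real) ^ (2 * (j + 2))"
      by (simp add: power_mult power_add)
    also have "ln \<dots> = 2 * (real j + 2) * ln 2" by (subst ln_realpow) simp_all
    finally have "ln (2 * real (card (G (Suc j))))
        \<le> ln 2 + 1 / 2 + real d * ((4 * real j + 8) * ln 2)"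
      using pos by (simp add: ln_mult algebra_simps)
    also have "\<dots> \<le> 25 / 36 + 1 / 2 + real d * ((4 * real j + 8) * (25 / 36))"
      using ln2_le_25_over_36 by (intro add_mono mult_left_mono) auto
    also have "\<dots> \<le> real d * (25 / 36 + 1 / 2) + real d * ((4 * real j + 8) * (25 / 36))"
      using assms(5) by simp
    also have "\<dots> \<le> real d * (7 + 3 * real j)"
      unfolding distrib_left[symmetric] by (intro mult_left_mono) (simp_all add: field_simps)
    finally show ?thesis .
  qed
  \<comment> \<open>The subtracted term is \<open>s\<close> times the total cost of all levels beyond \<open>j\<close>.\<close>
  have bound: "rademacher_complexity I (H j) \<le> s * (9 - (9 + 3 / 2 * real j) / 2 ^ j)" for j
  proof (induction j)
    case 0
    show ?case by (simp add: H_def rademacher_complexity_def rademacher_sum_def sign_mean_def)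
  next
    case (Suc j)
    \<comment> \<open>The best \<open>l\<close> for level \<open>j\<close> grows like \<open>2 ^ j * sqrt (j * d / n)\<close>. Without the
      factor \<open>sqrt j\<close> every term is a rational multiple of \<open>s / 2 ^ j\<close>, and the constant 4 makes
      these terms sum to \<open>9 * s\<close>.\<close>
    define l where "l = 4 * 2 ^ j * s / n"
    have l: "l > 0" using s(1) n by (simp add: l_def)
    have "rademacher_complexity I (H (Suc j)) \<le> rademacher_complexity I (H j)
        + (ln (2 * real (card (H (Suc j)))) + l\<^sup>2 * (n / 4 ^ j) / 2) / l"
    proof (rule rademacher_complexity_refine[OF assms(1) H(2) _ H(2) H(1) H(1) l])
      fix A assume A: "A \<in> H (Suc j)"
      have "\<exists>B\<in>H j. D A B \<le> n / 4 ^ j"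
      proof (cases "j = 0")
        case True
        have "A \<subseteq> I" using A H(1) by blast
        then have "D A {} \<le> n" using assms(1) by (simp add: D_def n_def card_mono)
        then show ?thesis using True by (simp add: H_def)
      next
        case False
        then show ?thesis using A G(3)[of A j] G(1)[of "Suc j"] by (auto simp: H_def)
      qed
      then show "\<exists>B\<in>H j. real (card (sym_diff A B)) \<le> n / 4 ^ j" by (simp add: D_def)
    qed (simp add: H_def G_ne)
    also have "(ln (2 * real (card (H (Suc j)))) + l\<^sup>2 * (n / 4 ^ j) / 2) / l
        \<le> (real d * (7 + 3 * real j) + l\<^sup>2 * (n / 4 ^ j) / 2) / l"
      using ln_card[of j] l by (intro divide_right_mono add_right_mono) (auto simp: H_def)
    also have "\<dots> = real d * n * (7 + 3 * real j) / (4 * 2 ^ j * s) + l * n / 4 ^ j / 2"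
      using s(1) n by (simp add: l_def field_simps power2_eq_square)
    also have "l * n / 4 ^ j / 2 = 2 * s / 2 ^ j"
      using n by (simp add: l_def field_simps power_mult_distrib[symmetric])
    also have "real d * n * (7 + 3 * real j) / (4 * 2 ^ j * s) = s * (7 + 3 * real j) / (4 * 2 ^ j)"
      unfolding s(2)[symmetric] using s(1) by (simp add: field_simps)
    also note Suc.IH
    also have "s * (9 - (9 + 3 / 2 * real j) / 2 ^ j) + (s * (7 + 3 * real j) / (4 * 2 ^ j) + 2 * s / 2 ^ j)
        = s * (9 - (9 + 3 / 2 * real (Suc j)) / 2 ^ Suc j)"
      by (simp add: field_simps)
    finally show ?case by simp
  qed
  have "F \<subseteq> H n"
  proof
    fix A assume "A \<in> F"
    then obtain B where B: "B \<in> G n" "D A B \<le> n / 4 ^ n" using G(3) by blast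
    have "real n < 4 ^ n"
      using of_nat_less_two_power[of n, where 'a = real] power_mono[of "2::real" 4 n] by linarith
    then have "n / 4 ^ n < 1" by simp
    with B(2) have "D A B < 1" by linarith
    then have "card (sym_diff A B) = 0" by (simp add: D_def)
    moreover have "finite (sym_diff A B)"
      using \<open>A \<in> F\<close> B(1) assms(1,3) G(1) by (meson PowD finite_Diff finite_UnI finite_subset subsetD)
    ultimately have "A = B" by auto
    then show "A \<in> H n" using B(1) n by (simp add: H_def)
  qed
  then have "H n = F" using G(1) n by (auto simp: H_def)
  then have "rademacher_complexity I F \<le> s * (9 - (9 + 3 / 2 * real n) / 2 ^ n)"
    using bound[of n] by simp
  also have "\<dots> \<le> s * 9" using s(1) by (intro mult_left_mono) auto
  finally show ?thesis by (simp add: s_def n_def mult.commute)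
qed

section \<open>Symmetrization\<close>

text \<open>The coordinate \<open>i + n\<close> holds the ghost of coordinate \<open>i\<close>. Exchanging the two for all \<open>i \<in> S\<close> only
  permutes the factors of a power of \<open>M\<close>.\<close>
lemma (in prob_space) integral_PiM_swap:
  fixes g :: "(nat \<Rightarrow> 'a) \<Rightarrow> real" and n :: nat
  defines "U \<equiv> {1..n} \<union> {n + 1..n + n}"
  assumes "g \<in> borel_measurable (PiM U (\<lambda>_. M))" "S \<subseteq> {1..n}"
  shows "(\<integral>z. g z \<partial>PiM U (\<lambda>_. M)) =
    (\<integral>z. g (\<lambda>i\<in>U. z (if i \<in> S then i + n else if n < i \<and> i - n \<in> S then i - n else i)) \<partial>PiM U (\<lambda>_. M))"
proof -
  define \<sigma> where "\<sigma> = (\<lambda>i. if i \<in> S then i + n else if n < i \<and> i - n \<in> S then i - n else i)"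
  have inv: "\<sigma> (\<sigma> i) = i" and into: "\<sigma> i \<in> U" if "i \<in> U" for i
    using that assms(3) by (auto simp: \<sigma>_def U_def subset_iff)
  have "inj_on \<sigma> U" using inv by (rule inj_on_inverseI)
  moreover have "\<sigma> \<in> U \<rightarrow> U" using into by blast
  ultimately have eq: "distr (PiM U (\<lambda>_. M)) (PiM U (\<lambda>_. M)) (\<lambda>z. \<lambda>i\<in>U. z (\<sigma> i)) = PiM U (\<lambda>_. M)"
    by (intro distr_PiM_reindex prob_space_axioms)
  have meas: "(\<lambda>z. \<lambda>i\<in>U. z (\<sigma> i)) \<in> PiM U (\<lambda>_. M) \<rightarrow>\<^sub>M PiM U (\<lambda>_. M)"
    using into by (intro measurable_restrict measurable_component_singleton)
  have "(\<integral>z. g z \<partial>PiM U (\<lambda>_. M)) = (\<integral>z. g z \<partial>distr (PiM U (\<lambda>_. M)) (PiM U (\<lambda>_. M)) (\<lambda>z. \<lambda>i\<in>U. z (\<sigma> i)))"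
    by (simp only: eq)
  also have "\<dots> = (\<integral>z. g (\<lambda>i\<in>U. z (\<sigma> i)) \<partial>PiM U (\<lambda>_. M))"
    by (rule integral_distr[OF meas assms(2)])
  finally show ?thesis by (simp only: \<sigma>_def)
qed

text \<open>Here \<open>h S k z\<close> is the signed sum of the differences between sample and ghost, and \<open>S = I\<close>
  gives plain differences. Since integration over the ghost turns the plain differences into the
  deviations from the mean, the maximal deviation is at most the ghost average of \<open>\<Phi> I\<close>. By exchange
  symmetry all \<open>\<Phi> S\<close> have the same integral, so \<open>\<Phi> I\<close> may be replaced by the average over \<open>S\<close>,
  to which the hypothesis applies pointwise, once for the sample and once for the ghost.\<close>
lemma (in prob_space) symmetrization:
  fixes f :: "'k \<Rightarrow> 'a \<Rightarrow> real" and n :: nat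
  assumes K: "finite K" "K \<noteq> {}"
    and meas: "\<And>k. k \<in> K \<Longrightarrow> f k \<in> borel_measurable M"
    and f1: "\<And>k x. k \<in> K \<Longrightarrow> \<bar>f k x\<bar> \<le> 1"
    and bound: "\<And>x. sign_mean {1..n} (\<lambda>S. MAX k\<in>K. \<bar>rademacher_sum {1..n} (\<lambda>i. f k (x i)) S\<bar>) \<le> b"
  shows "(\<integral>x. (MAX k\<in>K. \<bar>(\<Sum>i=1..n. f k (x i)) - real n * expectation (f k)\<bar>) \<partial>PiM {1..n} (\<lambda>_. M)) \<le> 2 * b"
proof -
  define I where "I = {1..n}"
  define J where "J = {n + 1..n + n}"
  have IJ: "finite I" "finite J" "I \<inter> J = {}" by (auto simp: I_def J_def)
  interpret prod: product_sigma_finite "\<lambda>_ :: nat. M" by unfold_locales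
  interpret PI: prob_space "PiM I (\<lambda>_. M)" by (intro prob_space_PiM prob_space_axioms)
  interpret PJ: prob_space "PiM J (\<lambda>_. M)" by (intro prob_space_PiM prob_space_axioms)
  interpret PU: prob_space "PiM (I \<union> J) (\<lambda>_. M)" by (intro prob_space_PiM prob_space_axioms)
  have comp: "(\<lambda>z. f k (z i)) \<in> borel_measurable (PiM A (\<lambda>_. M))" if "k \<in> K" "i \<in> A" for k i and A :: "nat set"
    using measurable_compose[OF measurable_component_singleton[OF \<open>i \<in> A\<close>] meas[OF \<open>k \<in> K\<close>]] .
  define h where "h = (\<lambda>S k z. rademacher_sum I (\<lambda>i. f k (z i) - f k (z (i + n))) S)"
  define \<Phi> where "\<Phi> = (\<lambda>S z. MAX k\<in>K. \<bar>h S k z\<bar>)"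
  have h_meas: "h S k \<in> borel_measurable (PiM (I \<union> J) (\<lambda>_. M))" if "k \<in> K" for S k
    unfolding h_def rademacher_sum_def using that
    by (intro borel_measurable_sum borel_measurable_times borel_measurable_diff comp
        borel_measurable_const) (auto simp: I_def J_def)
  have h_bound: "\<bar>h S k z\<bar> \<le> 2 * real n" if "k \<in> K" for S k z
  proof -
    have "\<bar>h S k z\<bar> \<le> (\<Sum>i\<in>I. 2)"
      unfolding h_def rademacher_sum_def
    proof (rule order_trans[OF sum_abs sum_mono])
      fix i
      show "\<bar>(if i \<in> S then 1 else - 1) * (f k (z i) - f k (z (i + n)))\<bar> \<le> 2"
        using f1[OF that, of "z i"] f1[OF that, of "z (i + n)"] by (auto simp: abs_mult)
    qed
    then show ?thesis by (simp add: I_def)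
  qed
  have \<Phi>_meas: "\<Phi> S \<in> borel_measurable (PiM (I \<union> J) (\<lambda>_. M))" for S
    unfolding \<Phi>_def using K(1) h_meas by (intro borel_measurable_Max borel_measurable_abs) auto
  have \<Phi>_in: "\<exists>k\<in>K. \<Phi> S z = \<bar>h S k z\<bar>" for S z
  proof -
    have "\<Phi> S z \<in> (\<lambda>k. \<bar>h S k z\<bar>) ` K"
      unfolding \<Phi>_def using K by (intro Max_in) auto
    then show ?thesis by blast
  qed
  have \<Phi>_bound: "\<bar>\<Phi> S z\<bar> \<le> 2 * real n" for S z
    using \<Phi>_in[of S z] h_bound by fastforce
  have h_le_\<Phi>: "\<bar>h S k z\<bar> \<le> \<Phi> S z" if "k \<in> K" for S k z
    unfolding \<Phi>_def using that K(1) by (intro Max_ge) auto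
  have \<Phi>_int: "integrable (PiM (I \<union> J) (\<lambda>_. M)) (\<Phi> S)" for S
    using \<Phi>_bound by (intro PU.integrable_const_bound[of _ "2 * real n"] \<Phi>_meas) auto

  have merge_meas: "(\<lambda>y. merge I J (x, y)) \<in> PiM J (\<lambda>_. M) \<rightarrow>\<^sub>M PiM (I \<union> J) (\<lambda>_. M)"
    if "x \<in> space (PiM I (\<lambda>_. M))" for x
    using that by (intro measurable_compose[OF measurable_Pair1' measurable_merge])
  have \<Phi>_merge_int: "integrable (PiM J (\<lambda>_. M)) (\<lambda>y. \<Phi> I (merge I J (x, y)))"
    if "x \<in> space (PiM I (\<lambda>_. M))" for x
    using \<Phi>_bound measurable_compose[OF merge_meas[OF that] \<Phi>_meas]
    by (intro PJ.integrable_const_bound[of _ "2 * real n"]) auto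
  have ghost: "(MAX k\<in>K. \<bar>(\<Sum>i=1..n. f k (x i)) - real n * expectation (f k)\<bar>)
      \<le> (\<integral>y. \<Phi> I (merge I J (x, y)) \<partial>PiM J (\<lambda>_. M))" if x: "x \<in> space (PiM I (\<lambda>_. M))" for x
  proof (rule Max.boundedI)
    fix r assume "r \<in> (\<lambda>k. \<bar>(\<Sum>i=1..n. f k (x i)) - real n * expectation (f k)\<bar>) ` K"
    then obtain k where k: "k \<in> K" "r = \<bar>(\<Sum>i=1..n. f k (x i)) - real n * expectation (f k)\<bar>" by blast
    have int_f: "integrable (PiM J (\<lambda>_. M)) (\<lambda>y. f k (y j))" if "j \<in> J" for j
      using f1[OF k(1)] comp[OF k(1) that] by (intro PJ.integrable_const_bound[of _ 1]) auto
    have exp_f: "(\<integral>y. f k (y j) \<partial>PiM J (\<lambda>_. M)) = expectation (f k)" if "j \<in> J" for j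
    proof -
      have "expectation (f k) = (\<integral>u. f k u \<partial>distr (PiM J (\<lambda>_. M)) M (\<lambda>y. y j))"
        using that by (subst distr_PiM_component) (auto intro: prob_space_axioms)
      also have "\<dots> = (\<integral>y. f k (y j) \<partial>PiM J (\<lambda>_. M))"
        by (rule integral_distr[OF measurable_component_singleton[OF that] meas[OF k(1)]])
      finally show ?thesis by simp
    qed
    have h_merge: "h I k (merge I J (x, y)) = (\<Sum>i\<in>I. f k (x i) - f k (y (i + n)))" for y
      unfolding h_def rademacher_sum_def
      by (intro sum.cong) (auto simp: merge_def I_def J_def)
    have shift: "i + n \<in> J" if "i \<in> I" for i using that by (auto simp: I_def J_def)
    have "(\<integral>y. h I k (merge I J (x, y)) \<partial>PiM J (\<lambda>_. M))
        = (\<Sum>i\<in>I. \<integral>y. f k (x i) - f k (y (i + n)) \<partial>PiM J (\<lambda>_. M))"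
      unfolding h_merge
      by (intro Bochner_Integration.integral_sum Bochner_Integration.integrable_diff int_f shift) auto
    also have "\<dots> = (\<Sum>i\<in>I. f k (x i) - expectation (f k))"
      using shift by (intro sum.cong refl)
        (simp add: Bochner_Integration.integral_diff int_f exp_f PJ.prob_space)
    also have "\<dots> = (\<Sum>i=1..n. f k (x i)) - real n * expectation (f k)"
      by (simp add: sum_subtractf I_def)
    finally have "r = \<bar>\<integral>y. h I k (merge I J (x, y)) \<partial>PiM J (\<lambda>_. M)\<bar>" using k(2) by simp
    also have "\<dots> \<le> (\<integral>y. \<bar>h I k (merge I J (x, y))\<bar> \<partial>PiM J (\<lambda>_. M))"
      by (rule integral_abs_bound)
    also have "\<dots> \<le> (\<integral>y. \<Phi> I (merge I J (x, y)) \<partial>PiM J (\<lambda>_. M))"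
    proof (rule integral_mono)
      show "integrable (PiM J (\<lambda>_. M)) (\<lambda>y. \<bar>h I k (merge I J (x, y))\<bar>)"
        using h_bound[OF k(1)] measurable_compose[OF merge_meas[OF x] h_meas[OF k(1)]]
        by (intro integrable_abs PJ.integrable_const_bound[of _ "2 * real n"]) auto
      show "integrable (PiM J (\<lambda>_. M)) (\<lambda>y. \<Phi> I (merge I J (x, y)))"
        by (rule \<Phi>_merge_int[OF x])
    qed (rule h_le_\<Phi>[OF k(1)])
    finally show "r \<le> (\<integral>y. \<Phi> I (merge I J (x, y)) \<partial>PiM J (\<lambda>_. M))" .
  qed (use K in auto)

  have swap: "(\<integral>z. \<Phi> I z \<partial>PiM (I \<union> J) (\<lambda>_. M)) = (\<integral>z. \<Phi> S z \<partial>PiM (I \<union> J) (\<lambda>_. M))" if "S \<subseteq> I" for S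
  proof -
    have sub: "I - S \<subseteq> {1..n}" by (auto simp: I_def)
    have "(\<integral>z. \<Phi> I z \<partial>PiM (I \<union> J) (\<lambda>_. M)) = (\<integral>z. \<Phi> I (\<lambda>i\<in>I \<union> J. z (if i \<in> I - S then i + n
        else if n < i \<and> i - n \<in> I - S then i - n else i)) \<partial>PiM (I \<union> J) (\<lambda>_. M))"
      using integral_PiM_swap[of "\<Phi> I" n, OF _ sub] \<Phi>_meas[of I] unfolding I_def J_def by blast
    also have "\<dots> = (\<integral>z. \<Phi> S z \<partial>PiM (I \<union> J) (\<lambda>_. M))"
      unfolding \<Phi>_def h_def rademacher_sum_def
      by (intro Bochner_Integration.integral_cong refl arg_cong[where f = Max] image_cong arg_cong[where f = abs] sum.cong)
        (auto simp: I_def J_def)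
    finally show ?thesis .
  qed

  have signs: "sign_mean I (\<lambda>S. \<Phi> S z) \<le> 2 * b" for z
  proof -
    have "sign_mean I (\<lambda>S. \<Phi> S z) \<le> sign_mean I (\<lambda>S.
        (MAX k\<in>K. \<bar>rademacher_sum I (\<lambda>i. f k (z i)) S\<bar>)
        + (MAX k\<in>K. \<bar>rademacher_sum I (\<lambda>i. f k (z (i + n))) S\<bar>))"
    proof (rule sign_mean_mono)
      fix S
      obtain k where k: "k \<in> K" "\<Phi> S z = \<bar>h S k z\<bar>" using \<Phi>_in by blast
      have "\<Phi> S z \<le> \<bar>rademacher_sum I (\<lambda>i. f k (z i)) S\<bar> + \<bar>rademacher_sum I (\<lambda>i. f k (z (i + n))) S\<bar>"
        unfolding k(2) h_def rademacher_sum_diff by linarith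
      also have "\<dots> \<le> (MAX k\<in>K. \<bar>rademacher_sum I (\<lambda>i. f k (z i)) S\<bar>)
          + (MAX k\<in>K. \<bar>rademacher_sum I (\<lambda>i. f k (z (i + n))) S\<bar>)"
        using k(1) K(1) by (intro add_mono Max_ge) auto
      finally show "\<Phi> S z \<le> (MAX k\<in>K. \<bar>rademacher_sum I (\<lambda>i. f k (z i)) S\<bar>)
          + (MAX k\<in>K. \<bar>rademacher_sum I (\<lambda>i. f k (z (i + n))) S\<bar>)" .
    qed
    also have "\<dots> \<le> b + b"
      unfolding sign_mean_add I_def using bound[of z] bound[of "\<lambda>i. z (i + n)"] by (rule add_mono)
    finally show ?thesis by simp
  qed

  have dev_meas: "(\<lambda>x. MAX k\<in>K. \<bar>(\<Sum>i=1..n. f k (x i)) - real n * expectation (f k)\<bar>)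
      \<in> borel_measurable (PiM I (\<lambda>_. M))"
    using K(1) comp by (intro borel_measurable_Max borel_measurable_abs borel_measurable_diff
        borel_measurable_sum borel_measurable_const) (auto simp: I_def)
  have "(\<integral>x. (MAX k\<in>K. \<bar>(\<Sum>i=1..n. f k (x i)) - real n * expectation (f k)\<bar>) \<partial>PiM I (\<lambda>_. M))
      \<le> (\<integral>x. (\<integral>y. \<Phi> I (merge I J (x, y)) \<partial>PiM J (\<lambda>_. M)) \<partial>PiM I (\<lambda>_. M))"
  proof (rule integral_mono)
    show int: "integrable (PiM I (\<lambda>_. M)) (\<lambda>x. \<integral>y. \<Phi> I (merge I J (x, y)) \<partial>PiM J (\<lambda>_. M))"
    proof (rule PI.integrable_const_bound[of _ "2 * real n"])
      show "AE x in PiM I (\<lambda>_. M). norm (\<integral>y. \<Phi> I (merge I J (x, y)) \<partial>PiM J (\<lambda>_. M)) \<le> 2 * real n"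
      proof (rule AE_I2)
        fix x assume x: "x \<in> space (PiM I (\<lambda>_. M))"
        have "0 \<le> \<Phi> I (merge I J (x, y))" for y
          using \<Phi>_in[of I "merge I J (x, y)"] by auto
        then have "0 \<le> (\<integral>y. \<Phi> I (merge I J (x, y)) \<partial>PiM J (\<lambda>_. M))"
          by simp
        moreover have "(\<integral>y. \<Phi> I (merge I J (x, y)) \<partial>PiM J (\<lambda>_. M)) \<le> 2 * real n"
          using abs_le_D1[OF \<Phi>_bound] by (intro PJ.integral_le_const \<Phi>_merge_int[OF x]) auto
        ultimately show "norm (\<integral>y. \<Phi> I (merge I J (x, y)) \<partial>PiM J (\<lambda>_. M)) \<le> 2 * real n"
          by simp
      qed
      show "(\<lambda>x. \<integral>y. \<Phi> I (merge I J (x, y)) \<partial>PiM J (\<lambda>_. M)) \<in> borel_measurable (PiM I (\<lambda>_. M))"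
        using \<Phi>_meas[of I] by measurable
    qed
    show "integrable (PiM I (\<lambda>_. M))
        (\<lambda>x. MAX k\<in>K. \<bar>(\<Sum>i=1..n. f k (x i)) - real n * expectation (f k)\<bar>)"
    proof (rule Bochner_Integration.integrable_bound[OF int dev_meas AE_I2])
      fix x assume x: "x \<in> space (PiM I (\<lambda>_. M))"
      have "0 \<le> (MAX k\<in>K. \<bar>(\<Sum>i=1..n. f k (x i)) - real n * expectation (f k)\<bar>)"
        using K by (subst Max_ge_iff) auto
      then show "norm (MAX k\<in>K. \<bar>(\<Sum>i=1..n. f k (x i)) - real n * expectation (f k)\<bar>)
          \<le> norm (\<integral>y. \<Phi> I (merge I J (x, y)) \<partial>PiM J (\<lambda>_. M))"
        using ghost[OF x] by simp
    qed
  qed (rule ghost)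
  also have "\<dots> = (\<integral>z. \<Phi> I z \<partial>PiM (I \<union> J) (\<lambda>_. M))"
    by (rule prod.product_integral_fold[OF IJ(3,1,2) \<Phi>_int, symmetric])
  also have "\<dots> = sign_mean I (\<lambda>S. \<integral>z. \<Phi> I z \<partial>PiM (I \<union> J) (\<lambda>_. M))"
    using IJ(1) by (simp add: sign_mean_const)
  also have "\<dots> = sign_mean I (\<lambda>S. \<integral>z. \<Phi> S z \<partial>PiM (I \<union> J) (\<lambda>_. M))"
    unfolding sign_mean_def by (intro arg_cong2[where f = "(/)"] sum.cong refl swap) auto
  also have "\<dots> = (\<integral>z. sign_mean I (\<lambda>S. \<Phi> S z) \<partial>PiM (I \<union> J) (\<lambda>_. M))"
    unfolding sign_mean_def using \<Phi>_int by (simp add: Bochner_Integration.integral_sum)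
  also have "\<dots> \<le> (\<integral>z. 2 * b \<partial>PiM (I \<union> J) (\<lambda>_. M))"
    using \<Phi>_int signs by (intro integral_mono) (auto simp: sign_mean_def)
  also have "\<dots> = 2 * b" by (simp add: PU.prob_space)
  finally show ?thesis by (simp add: I_def)
qed

section \<open>Uniform deviations over a VC class\<close>

text \<open>Traces are taken on indices rather than on points, as a sample may repeat a point. Repetitions do
  not help to shatter: two indices of the same point always lie in the same traces.\<close>
lemma shattered_trace_image:
  assumes "shatters ((\<lambda>C. {i\<in>I. x i \<in> C}) ` \<C>) S"
  shows "shatters \<C> (x ` S)" "inj_on x S"
proof -
  have "S \<subseteq> I" using shattersD[OF assms subset_refl] by blast
  have tr: "\<exists>C\<in>\<C>. B = {i\<in>S. x i \<in> C}" if B: "B \<subseteq> S" for B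
  proof -
    obtain C where "C \<in> \<C>" "B = S \<inter> {i\<in>I. x i \<in> C}" using shattersD[OF assms B] by (elim bexE imageE) simp
    then show ?thesis using \<open>S \<subseteq> I\<close> by (intro bexI[of _ C]) auto
  qed
  show inj: "inj_on x S"
  proof (rule inj_onI)
    fix i j assume ij: "i \<in> S" "j \<in> S" "x i = x j"
    have "{i} \<subseteq> S" using ij(1) by simp
    from tr[OF this] obtain C where C: "{i} = {l\<in>S. x l \<in> C}" by (elim bexE)
    then have "x i \<in> C" by blast
    then have "j \<in> {l\<in>S. x l \<in> C}" using ij by simp
    then show "i = j" unfolding C[symmetric] by simp
  qed
  show "shatters \<C> (x ` S)"
  proof (rule shattersI)
    fix B assume B: "B \<subseteq> x ` S"
    have "{i\<in>S. x i \<in> B} \<subseteq> S" by blast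
    from tr[OF this] obtain C where C: "C \<in> \<C>" "{i\<in>S. x i \<in> B} = {i\<in>S. x i \<in> C}"
      by (elim bexE)
    from C(2) have "x i \<in> B \<longleftrightarrow> x i \<in> C" if "i \<in> S" for i using that by blast
    then show "\<exists>C\<in>\<C>. B = x ` S \<inter> C" using B C(1) by (intro bexI[of _ C]) auto
  qed (simp add: shatters_finite[OF assms])
qed

lemma (in prob_space) integral_vc_deviation_le:
  assumes "finite \<D>" "\<D> \<noteq> {}" "\<D> \<subseteq> events" "n > 0" "d \<ge> 1"
    and vc: "\<And>A. A \<subseteq> space M \<Longrightarrow> shatters \<D> A \<Longrightarrow> card A \<le> d"
  shows "(\<integral>x. (MAX C\<in>\<D>. \<bar>(\<Sum>i=1..n. indicator C (x i)) - real n * prob C\<bar>) \<partial>PiM {1..n} (\<lambda>_. M))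
    \<le> 18 * sqrt (real d * real n)"
proof -
  have "(\<integral>x. (MAX C\<in>\<D>. \<bar>(\<Sum>i=1..n. indicator C (x i)) - real n * expectation (indicator C)\<bar>)
      \<partial>PiM {1..n} (\<lambda>_. M)) \<le> 2 * (9 * sqrt (real d * real n))"
  proof (rule symmetrization[OF assms(1,2)])
    fix x :: "nat \<Rightarrow> 'a"
    define tr where "tr = (\<lambda>C. {i\<in>{1..n}. x i \<in> C})"
    have "(MAX C\<in>\<D>. \<bar>rademacher_sum {1..n} (\<lambda>i. indicator C (x i)) S\<bar>)
        = (MAX A\<in>tr ` \<D>. \<bar>rademacher_sum {1..n} (indicator A) S\<bar>)" for S
    proof -
      have "rademacher_sum {1..n} (\<lambda>i. indicator C (x i)) S = rademacher_sum {1..n} (indicator (tr C)) S" for C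
        unfolding rademacher_sum_def by (intro sum.cong) (auto simp: tr_def indicator_def)
      then show ?thesis by (simp add: image_image)
    qed
    then have "sign_mean {1..n} (\<lambda>S. MAX C\<in>\<D>. \<bar>rademacher_sum {1..n} (\<lambda>i. indicator C (x i)) S\<bar>)
        = rademacher_complexity {1..n} (tr ` \<D>)"
      by (simp add: rademacher_complexity_def)
    also have "\<dots> \<le> 9 * sqrt (real d * real (card {1..n}))"
    proof (rule rademacher_complexity_vc)
      fix S assume S: "shatters (tr ` \<D>) S"
      have sh: "shatters \<D> (x ` S)" and inj: "inj_on x S"
        using shattered_trace_image[OF S[unfolded tr_def]] by blast+
      obtain C where "C \<in> \<D>" "x ` S = x ` S \<inter> C" using shattersD[OF sh subset_refl] by blast
      then have "x ` S \<subseteq> space M" using assms(3) sets.sets_into_space by blast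
      then show "card S \<le> d" using vc[OF _ sh] card_image[OF inj] by simp
    qed (use assms in \<open>auto simp: tr_def\<close>)
    finally show "sign_mean {1..n} (\<lambda>S. MAX C\<in>\<D>. \<bar>rademacher_sum {1..n} (\<lambda>i. indicator C (x i)) S\<bar>)
        \<le> 9 * sqrt (real d * real n)" by simp
  qed (use assms(3) in \<open>auto simp: indicator_def\<close>)
  moreover have "expectation (indicator C) = prob C" if "C \<in> \<D>" for C
    using that assms(3) by (simp add: subset_iff)
  ultimately show ?thesis by simp
qed

lemma (in prob_space) prob_vc_deviation_le_half:
  fixes r :: real
  assumes "finite \<D>" "\<D> \<noteq> {}" "\<D> \<subseteq> events" "n > 0" "d \<ge> 1"
    and vc: "\<And>A. A \<subseteq> space M \<Longrightarrow> shatters \<D> A \<Longrightarrow> card A \<le> d"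
    and "r > 0" "36 * sqrt (real d * real n) \<le> r"
  shows "measure (PiM {1..n} (\<lambda>_. M)) {x \<in> space (PiM {1..n} (\<lambda>_. M)).
     \<exists>C\<in>\<D>. r < \<bar>(\<Sum>i=1..n. indicator C (x i)) - real n * prob C\<bar>} \<le> 1 / 2"
proof -
  let ?P = "PiM {1..n} (\<lambda>_. M)"
  interpret P: prob_space ?P by (intro prob_space_PiM prob_space_axioms)
  define g where "g = (\<lambda>C x. \<bar>(\<Sum>i=1..n. indicator C (x i)) - real n * prob C\<bar>)"
  define m where "m = (\<lambda>x. MAX C\<in>\<D>. g C x)"
  have comp: "(\<lambda>x. indicator C (x i) :: real) \<in> borel_measurable ?P" if "C \<in> \<D>" "i \<in> {1..n}" for C i
    using that assms(3)
    by (intro measurable_compose[OF measurable_component_singleton] borel_measurable_indicator) auto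
  have g_meas: "g C \<in> borel_measurable ?P" if "C \<in> \<D>" for C
    unfolding g_def using comp[OF that]
    by (intro borel_measurable_abs borel_measurable_diff borel_measurable_sum borel_measurable_const)
  have m_meas: "m \<in> borel_measurable ?P"
    unfolding m_def using assms(1) g_meas by (rule borel_measurable_Max)
  have g_bound: "0 \<le> g C x" "g C x \<le> real n" for C x
  proof -
    have "0 \<le> (\<Sum>i=1..n. indicator C (x i) :: real)" by (intro sum_nonneg) auto
    moreover have "(\<Sum>i=1..n. indicator C (x i) :: real) \<le> real n"
      using sum_bounded_above[of "{1..n}" "\<lambda>i. indicator C (x i) :: real" 1]
      by (simp add: indicator_def)
    moreover have "0 \<le> real n * prob C" "real n * prob C \<le> real n"
      using prob_le_1[of C] by (simp_all add: mult_left_le)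
    ultimately show "0 \<le> g C x" "g C x \<le> real n" unfolding g_def by linarith+
  qed
  have m_in: "\<exists>C\<in>\<D>. m x = g C x" for x
  proof -
    have "m x \<in> (\<lambda>C. g C x) ` \<D>" unfolding m_def using assms(1,2) by (intro Max_in) auto
    then show ?thesis by blast
  qed
  have m_bound: "0 \<le> m x" "m x \<le> real n" for x
    using m_in[of x] g_bound by auto
  have m_int: "integrable ?P m"
    using m_bound m_meas by (intro P.integrable_const_bound[of _ "real n"]) auto
  have "{x \<in> space ?P. \<exists>C\<in>\<D>. r < g C x} \<subseteq> {x \<in> space ?P. r \<le> m x}"
  proof (intro subsetI CollectI conjI; elim CollectE conjE bexE)
    fix x C assume "C \<in> \<D>" "r < g C x"
    moreover have "g C x \<le> m x" unfolding m_def using \<open>C \<in> \<D>\<close> assms(1) by (intro Max_ge) auto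
    ultimately show "r \<le> m x" by simp
  qed
  then have "measure ?P {x \<in> space ?P. \<exists>C\<in>\<D>. r < g C x} \<le> measure ?P {x \<in> space ?P. r \<le> m x}"
    using m_meas by (intro P.finite_measure_mono) measurable
  also have "\<dots> \<le> (\<integral>x. m x \<partial>?P) / r"
    using m_int m_bound assms(7) by (intro integral_Markov_inequality_measure[where A = "{}"]) auto
  also have "\<dots> \<le> (18 * sqrt (real d * real n)) / r"
    using integral_vc_deviation_le[OF assms(1-5) vc] assms(7)
    by (intro divide_right_mono) (auto simp: m_def g_def)
  also have "\<dots> \<le> 1 / 2" using assms(7,8) by (simp add: field_simps)
  finally show ?thesis by (simp add: g_def)
qed

text \<open>The bound one half for finite subfamilies does not depend on their size, so it survives the
  increasing union over an enumeration of \<open>\<C>\<close>, and some sample lies outside that union.\<close>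
lemma (in prob_space) ex_sample_vc_deviation_le:
  fixes r :: real
  assumes "countable \<C>" "\<C> \<noteq> {}" "\<C> \<subseteq> events" "n > 0" "d \<ge> 1"
    and vc: "\<And>A. A \<subseteq> space M \<Longrightarrow> shatters \<C> A \<Longrightarrow> card A \<le> d"
    and "r > 0" "36 * sqrt (real d * real n) \<le> r"
  shows "\<exists>x. (\<forall>i\<in>{1..n}. x i \<in> space M) \<and>
    (\<forall>C\<in>\<C>. \<bar>(\<Sum>i=1..n. indicator C (x i)) - real n * prob C\<bar> \<le> r)"
proof -
  let ?P = "PiM {1..n} (\<lambda>_. M)"
  interpret P: prob_space ?P by (intro prob_space_PiM prob_space_axioms)
  define c where "c = from_nat_into \<C>"
  have range_c: "range c = \<C>" unfolding c_def using assms(1,2) by (rule range_from_nat_into[rotated])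
  define g where "g = (\<lambda>C x. \<bar>(\<Sum>i=1..n. indicator C (x i)) - real n * prob C\<bar>)"
  define bad where "bad = (\<lambda>k. {x \<in> space ?P. \<exists>C\<in>c ` {..k}. r < g C x})"
  have comp: "(\<lambda>x. indicator C (x i) :: real) \<in> borel_measurable ?P" if "C \<in> \<C>" "i \<in> {1..n}" for C i
    using that assms(3)
    by (intro measurable_compose[OF measurable_component_singleton] borel_measurable_indicator) auto
  have g_meas: "g C \<in> borel_measurable ?P" if "C \<in> \<C>" for C
    unfolding g_def using comp[OF that]
    by (intro borel_measurable_abs borel_measurable_diff borel_measurable_sum borel_measurable_const)
  have bad_sets: "bad k \<in> sets ?P" for k
  proof -
    have "bad k = (\<Union>C\<in>c ` {..k}. {x \<in> space ?P. r < g C x})" by (auto simp: bad_def)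
    also have "\<dots> \<in> sets ?P"
    proof (rule sets.finite_UN)
      fix C assume "C \<in> c ` {..k}"
      then have "g C \<in> borel_measurable ?P" using range_c by (intro g_meas) auto
      then show "{x \<in> space ?P. r < g C x} \<in> sets ?P" by measurable
    qed simp
    finally show ?thesis .
  qed
  have le_half: "measure ?P (bad k) \<le> 1 / 2" for k
    unfolding bad_def g_def
  proof (rule prob_vc_deviation_le_half)
    have sub: "c ` {..k} \<subseteq> \<C>" using range_c by auto
    then show "c ` {..k} \<subseteq> events" using assms(3) by auto
    fix A assume A: "A \<subseteq> space M" "shatters (c ` {..k}) A"
    have "shatters \<C> A"
      using shatters_finite[OF A(2)]
    proof (rule shattersI)
      fix B assume "B \<subseteq> A"
      from shattersD[OF A(2) this] sub show "\<exists>C\<in>\<C>. B = A \<inter> C" by (elim bexE) (rule bexI, auto)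
    qed
    then show "card A \<le> d" by (rule vc[OF A(1)])
  qed (use assms in auto)
  have "incseq bad" by (force simp: incseq_def bad_def)
  then have "(\<lambda>k. measure ?P (bad k)) \<longlonglongrightarrow> measure ?P (\<Union>k. bad k)"
    using bad_sets by (intro P.finite_Lim_measure_incseq) auto
  then have "measure ?P (\<Union>k. bad k) \<le> 1 / 2"
    by (rule LIMSEQ_le_const2) (use le_half in auto)
  then have "(\<Union>k. bad k) \<noteq> space ?P" using P.prob_space by auto
  moreover have "(\<Union>k. bad k) \<subseteq> space ?P" by (auto simp: bad_def)
  ultimately obtain x where x: "x \<in> space ?P" "\<And>k. x \<notin> bad k" by blast
  show ?thesis
  proof (intro exI conjI ballI)
    show "x i \<in> space M" if "i \<in> {1..n}" for i
      using x(1) that by (auto simp: space_PiM PiE_def)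
    fix C assume "C \<in> \<C>"
    then obtain k where "C = c k" using range_c by blast
    then have "\<not> r < g C x" using x(1) x(2)[of k] by (auto simp: bad_def)
    then show "\<bar>(\<Sum>i=1..n. indicator C (x i)) - real n * prob C\<bar> \<le> r" by (simp add: g_def)
  qed
qed

theorem theorem3:
  fixes M :: "'a measure" and \<C> :: "'a set set" and d :: nat and \<epsilon> :: real
  assumes "prob_space M"
    and "\<C> \<subseteq> sets M"
    and "countable \<C>"
    and "VC_class (space M) \<C> d"
    and "d \<ge> 1"
    and "0 < \<epsilon>" and "\<epsilon> < 1"
  shows "\<exists>n::nat. n > 0 \<and> real n \<le> 2576 * real d * (1 + \<epsilon>) / \<epsilon>\<^sup>2 \<and>
           (\<exists>x :: nat \<Rightarrow> 'a. (\<forall>i\<in>{1..n}. x i \<in> space M) \<and> discrepancy \<C> M n x \<le> \<epsilon>)"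
proof -
  interpret prob_space M by fact
  \<comment> \<open>\<open>1296 = 36\<^sup>2\<close> makes \<open>36 * sqrt (d * n) \<le> n * \<epsilon>\<close>, twice the bound on the expectation.\<close>
  define n where "n = nat \<lceil>1296 * real d / \<epsilon>\<^sup>2\<rceil>"
  have large: "1 \<le> real d / \<epsilon>\<^sup>2"
    using assms(5-7) power_le_one[of \<epsilon> 2] by (simp add: le_divide_eq)
  have n: "1296 * real d / \<epsilon>\<^sup>2 \<le> real n" "real n \<le> 1296 * real d / \<epsilon>\<^sup>2 + 1"
    unfolding n_def using large by (linarith+)
  have pos: "n > 0" using n(1) large by (intro gr0I) simp
  have "real n \<le> 2576 * (real d / \<epsilon>\<^sup>2) * 1" using n(2) large by simp
  also have "\<dots> \<le> 2576 * (real d / \<epsilon>\<^sup>2) * (1 + \<epsilon>)" using assms(6) by (intro mult_left_mono) auto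
  finally have n_le: "real n \<le> 2576 * real d * (1 + \<epsilon>) / \<epsilon>\<^sup>2" by simp
  have "36 * sqrt (real d * real n) = sqrt (1296 * real d * real n)"
    by (simp add: real_sqrt_mult)
  also have "\<dots> \<le> sqrt ((real n * \<epsilon>)\<^sup>2)"
  proof (rule real_sqrt_le_mono)
    have "1296 * real d \<le> real n * \<epsilon>\<^sup>2" using n(1) assms(6) by (simp add: divide_le_eq)
    then have "1296 * real d * real n \<le> real n * \<epsilon>\<^sup>2 * real n" by (intro mult_right_mono) auto
    then show "1296 * real d * real n \<le> (real n * \<epsilon>)\<^sup>2"
      by (simp add: power2_eq_square mult_ac)
  qed
  also have "\<dots> = real n * \<epsilon>" using assms(6) by simp
  finally have scale: "36 * sqrt (real d * real n) \<le> real n * \<epsilon>" .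
  have ne: "\<C> \<noteq> {}" using assms(4) by (auto simp: VC_class_def shatters_def)
  have vc: "card A \<le> d" if "A \<subseteq> space M" "shatters \<C> A" for A
    using assms(4) that by (simp add: VC_class_def)
  obtain x where x: "\<forall>i\<in>{1..n}. x i \<in> space M"
    "\<And>C. C \<in> \<C> \<Longrightarrow> \<bar>(\<Sum>i=1..n. indicator C (x i)) - real n * prob C\<bar> \<le> real n * \<epsilon>"
    using ex_sample_vc_deviation_le[OF assms(3) ne assms(2) pos assms(5) vc _ scale] pos assms(6)
    by auto
  have "discrepancy \<C> M n x \<le> \<epsilon>"
    unfolding discrepancy_def
  proof (rule cSUP_least[OF ne])
    fix C assume "C \<in> \<C>"
    have "1 / real n * (\<Sum>i=1..n. indicator C (x i)) - prob C
        = ((\<Sum>i=1..n. indicator C (x i)) - real n * prob C) / real n"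
      using pos by (simp add: field_simps)
    then have "\<bar>1 / real n * (\<Sum>i=1..n. indicator C (x i)) - prob C\<bar>
        = \<bar>(\<Sum>i=1..n. indicator C (x i)) - real n * prob C\<bar> / real n"
      by simp
    also have "\<dots> \<le> \<epsilon>" using x(2)[OF \<open>C \<in> \<C>\<close>] pos by (simp add: field_simps)
    finally show "\<bar>1 / real n * (\<Sum>i=1..n. indicator C (x i)) - prob C\<bar> \<le> \<epsilon>" .
  qed
  then show ?thesis using pos n_le x(1) by blast
qed

end
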